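(* Let $X_1,X_2,\ldots$ be i.i.d. centered real random variables with unit variance and finite third absolute moment $\beta=\mathsf E|X_1|^3$. For $n\in\mathbb N$ let $S_n:=(X_1+\ldots+X_n)/\sqrt n$, $\varepsilon_n:=\beta/\sqrt n$, $f_{S_n}(t):=\mathsf Ee^{itS_n}$, $\varphi(t):=\exp(-t^2/2)$ and $\delta_n(t):=|f_{S_n}(t)-\varphi(t)|$. Then for every $n\in\mathbb N$ and every $t\in\mathbb R$ $$|f_{S_n}(t)|\le\left(1+\frac{b(t,\varepsilon_n+1/\sqrt n)}n\right)^{n/2},$$ $$\delta_n(t)\le\varepsilon_n\varphi(t)\int_0^{|t|}\left(1+\frac{b(s,\varepsilon_n+1/\sqrt n)}n\right)^{\frac{n-1}2}\frac{s^2}2\exp\left(\frac{s^2}2\right)ds .$$ Furthermore, let $m\in\mathbb N$ and $n\ge m$. Then for every $t\in\mathbb R$ $$|f_{S_n}(t)|\le\exp\left(\tfrac12\,b(t,\varepsilon_n+1/\sqrt m)\right),$$ $$\delta_n(t)\le\varepsilon_n\varphi(t)\int_0^{|t|}\exp\left(\frac{m-1}{2m}\,b(s,\varepsilon_n+1/\sqrt m)+\frac{s^2}2\right)\frac{s^2}2\,ds .$$ The function $b$ is as defined in the context.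
   Context: Let $a:=\max_{x>0}\dfrac{\cos x-1+x^2/2}{x^3}\approx0.099162$ and let $M\approx3.995896$ be the point where this maximum is attained. For $\gamma>0$ and $t\in\mathbb R$ set $$b(t,\gamma):=\begin{cases}-t^2+2\gamma a|t|^3, & \gamma|t|<M,\\ -2\gamma^{-2}\left(1-\cos(\gamma t)\right), & M\le\gamma|t|\le2\pi,\\ 0, & \gamma|t|>2\pi.\end{cases}$$ *)

theory Defs
  imports "HOL-Probability.Probability"
begin

definition cos_ratio :: "real \<Rightarrow> real" where
  "cos_ratio x = (cos x - 1 + x\<^sup>2 / 2) / x ^ 3"

text \<open>
  The function \<^const>\<open>cos_ratio\<close> tends to 0 at \<open>0+\<close> and at infinity, so on the positive half-line
  its supremum is a maximum. It is attained at exactly one point, so the choice made by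
  \<^const>\<open>arg_max_on\<close> is forced. Numerically \<open>a_const\<close> is about 0.099162 and \<open>M_const\<close> about 3.995896.
\<close>

definition a_const :: real where
  "a_const = (SUP x\<in>{0<..}. cos_ratio x)"

definition M_const :: real where
  "M_const = arg_max_on cos_ratio {0<..}"

definition b_fun :: "real \<Rightarrow> real \<Rightarrow> real" where
  "b_fun t \<gamma> =
    (if \<gamma> * \<bar>t\<bar> < M_const then - t\<^sup>2 + 2 * \<gamma> * a_const * \<bar>t\<bar> ^ 3
     else if \<gamma> * \<bar>t\<bar> \<le> 2 * pi then - 2 / \<gamma>\<^sup>2 * (1 - cos (\<gamma> * t))
     else 0)"

definition normalized_sum :: "(nat \<Rightarrow> 'a \<Rightarrow> real) \<Rightarrow> nat \<Rightarrow> 'a \<Rightarrow> real" where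
  "normalized_sum X n \<omega> = (\<Sum>i\<in>{1..n}. X i \<omega>) / sqrt (real n)"

definition sum_cf :: "'a measure \<Rightarrow> (nat \<Rightarrow> 'a \<Rightarrow> real) \<Rightarrow> nat \<Rightarrow> real \<Rightarrow> complex" where
  "sum_cf P X n = char (distr P borel (normalized_sum X n))"

definition normal_cf :: "real \<Rightarrow> real" where
  "normal_cf t = exp (- t\<^sup>2 / 2)"

definition cf_dist :: "'a measure \<Rightarrow> (nat \<Rightarrow> 'a \<Rightarrow> real) \<Rightarrow> nat \<Rightarrow> real \<Rightarrow> real" where
  "cf_dist P X n t = cmod (sum_cf P X n t - complex_of_real (normal_cf t))"

definition lyapunov_fraction :: "'a measure \<Rightarrow> (nat \<Rightarrow> 'a \<Rightarrow> real) \<Rightarrow> nat \<Rightarrow> real" where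
  "lyapunov_fraction P X n = prob_space.expectation P (\<lambda>\<omega>. \<bar>X 1 \<omega>\<bar> ^ 3) / sqrt (real n)"

end

theory Submission
  imports Defs
begin

text \<open>
  The bound for the modulus comes from the symmetrization \<open>Y = X - X'\<close>, whose characteristic function is
  \<open>\<bar>f\<bar>\<^sup>2\<close>. Since \<open>\<bar>x - y\<bar> ^ 3 \<le> (\<bar>x\<bar> + \<bar>y\<bar>) * (x - y)\<^sup>2\<close>, its third absolute moment is at most
  \<open>2 * (\<beta> + 1)\<close>, while its second moment is \<open>2\<close>. With \<open>(1 - cos x) / x\<^sup>2 \<ge> A - C * x\<close> for a suitable
  supporting line this yields \<open>\<bar>f t\<bar>\<^sup>2 \<le> 1 + b (t, \<beta> + 1)\<close>.

  For the distance to the normal law, \<open>f\<^sup>n * exp (s\<^sup>2 / 2)\<close> is differentiated, and everything reduces to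
  \<open>\<bar>f' u + u * f u\<bar> \<le> \<beta> * u\<^sup>2 / 2\<close>. Over two independent copies \<open>X, Y\<close>, twice the left-hand side is the
  modulus of the expectation of \<open>(X - Y) * (u * (X * e Y - Y * e X) + \<i> * (e X - e Y))\<close> with \<open>e x = exp (\<i> * u * x)\<close>;
  this is bounded pointwise by \<open>u\<^sup>2 / 2 * (\<bar>X\<bar> ^ 3 + \<bar>Y\<bar> ^ 3 - X * Y * (\<bar>X\<bar> + \<bar>Y\<bar>))\<close>, and the mixed term
  has expectation \<open>0\<close>.
\<close>

subsection \<open>Supporting lines of \<open>(1 - cos x) / x\<^sup>2\<close>\<close>

definition cos_quot :: "real \<Rightarrow> real" where
  "cos_quot x = (1 - cos x) / x\<^sup>2"

definition cos_quot' :: "real \<Rightarrow> real" where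
  "cos_quot' x = (x * sin x - 2 * (1 - cos x)) / x ^ 3"

definition cos_quot'' :: "real \<Rightarrow> real" where
  "cos_quot'' x = (x\<^sup>2 * cos x - 4 * x * sin x + 6 * (1 - cos x)) / x ^ 4"

lemma cos_quot_deriv:
  assumes "x > 0"
  shows "(cos_quot has_real_derivative cos_quot' x) (at x)"
  unfolding cos_quot_def [abs_def] cos_quot'_def using assms
  by (auto intro!: derivative_eq_intros simp: field_simps power2_eq_square power3_eq_cube)

lemma cos_quot'_deriv:
  assumes "x > 0"
  shows "(cos_quot' has_real_derivative cos_quot'' x) (at x)"
  unfolding cos_quot'_def [abs_def] cos_quot''_def using assms
  by (auto intro!: derivative_eq_intros simp: divide_simps eval_nat_numeral algebra_simps)

lemma cos_quot_nonneg: "cos_quot x \<ge> 0"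
  by (simp add: cos_quot_def)

text \<open>Geometrically, \<open>cos_ratio x\<close> is minus the slope of the chord from (0, 1/2)
  to the point of the graph of \<open>cos_quot\<close> over x. Maximizing it yields the line
  \<open>1 / 2 - a_const * x\<close>, which touches this graph from below at
  \<open>M_const\<close>.\<close>

lemma cos_ratio_eq:
  assumes "x > 0"
  shows "cos_ratio x = (1 / 2 - cos_quot x) / x"
  using assms by (simp add: cos_ratio_def cos_quot_def field_simps power2_eq_square power3_eq_cube)

text \<open>Let N be the numerator. On [pi, 3 pi / 2] sine and cosine are nonpositive, which makes N
  nondecreasing from 12 - pi^2 > 0. On [3 pi / 2, 2 pi] every term of (x^2 - 6) cos x - 4 x sin x +
  6 is nonnegative.\<close>

lemma cos_quot''_nonneg:
  assumes "pi \<le> x" "x \<le> 2 * pi"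
  shows "cos_quot'' x \<ge> 0"
proof -
  define N where "N x = x\<^sup>2 * cos x - 4 * x * sin x + 6 * (1 - cos x)" for x :: real
  have pi: "pi > 3" "pi \<le> 3.2" using pi_gt3 pi_approx by auto
  have sin: "sin y \<le> 0" if "pi \<le> y" "y \<le> 2 * pi" for y
    using that sin_ge_zero[of "y - pi"] by (simp add: sin_diff)
  have "N x \<ge> 0"
  proof (cases "x \<le> 3 * pi / 2")
    case True
    have "N pi \<le> N x"
    proof (rule DERIV_nonneg_imp_nondecreasing[OF assms(1)])
      fix y assume y: "pi \<le> y" "y \<le> x"
      have "cos y \<le> 0"
        using y True cos_ge_zero[of "y - pi"] by (simp add: cos_diff)
      moreover have "sin y \<le> 0" using y assms by (intro sin) auto
      moreover have "y\<^sup>2 \<ge> 2"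
        using power_mono[of 3 y 2] y pi by simp
      ultimately have "y * cos y \<le> 0" "(2 - y\<^sup>2) * sin y \<ge> 0"
        using y pi by (auto intro!: mult_nonneg_nonpos mult_nonpos_nonpos)
      then have "- 2 * y * cos y + (2 - y\<^sup>2) * sin y \<ge> 0" by simp
      moreover have "(N has_real_derivative (- 2 * y * cos y + (2 - y\<^sup>2) * sin y)) (at y)"
        unfolding N_def [abs_def]
        by (auto intro!: derivative_eq_intros simp: algebra_simps power2_eq_square)
      ultimately show "\<exists>d. (N has_real_derivative d) (at y) \<and> d \<ge> 0" by blast
    qed
    moreover have "N pi \<ge> 0"
      using power_mono[of pi "3.2" 2] pi by (simp add: N_def power2_eq_square)
    ultimately show ?thesis by simp
  next
    case False
    have "cos x \<ge> 0"
      using False assms cos_ge_zero[of "x - 2 * pi"] by (simp add: cos_diff)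
    moreover have "sin x \<le> 0" using assms by (rule sin)
    moreover have "x\<^sup>2 \<ge> 6" using power_mono[of 3 x 2] assms pi by simp
    ultimately have "(x\<^sup>2 - 6) * cos x \<ge> 0" "x * sin x \<le> 0"
      using assms pi by (auto intro!: mult_nonneg_nonpos)
    then show ?thesis by (simp add: N_def algebra_simps)
  qed
  then show ?thesis by (simp add: cos_quot''_def N_def)
qed

lemma cos_quot_above_tangent:
  assumes "pi \<le> x" "x \<le> 2 * pi" "pi \<le> y" "y \<le> 2 * pi"
  shows "cos_quot' x * (y - x) \<le> cos_quot y - cos_quot x"
proof (rule f''_imp_f'[where C = "{pi..2 * pi}" and f'' = cos_quot''])
  have pos: "z > 0" if "z \<in> {pi..2 * pi}" for z :: real
    using that less_le_trans[OF pi_gt_zero] by auto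
  show "DERIV cos_quot z :> cos_quot' z" if "z \<in> {pi..2 * pi}" for z
    by (rule cos_quot_deriv[OF pos[OF that]])
  show "DERIV cos_quot' z :> cos_quot'' z" if "z \<in> {pi..2 * pi}" for z
    by (rule cos_quot'_deriv[OF pos[OF that]])
qed (use assms cos_quot''_nonneg in auto)

section \<open>Existence and location of the maximum of \<open>cos_ratio\<close>\<close>

definition cos_ratio_num' :: "real \<Rightarrow> real" where
  "cos_ratio_num' x = 3 * (1 - cos x) - x * sin x - x\<^sup>2 / 2"

lemma cos_ratio_deriv:
  assumes "x > 0"
  shows "(cos_ratio has_real_derivative cos_ratio_num' x / x ^ 4) (at x)"
  unfolding cos_ratio_def [abs_def] cos_ratio_num'_def using assms
  by (auto intro!: derivative_eq_intros simp: divide_simps eval_nat_numeral algebra_simps)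

lemma mult_cos_less_sin:
  fixes x :: real
  assumes "0 < x" "x < pi"
  shows "x * cos x < sin x"
proof -
  have "sin 0 - 0 * cos 0 < sin x - x * cos x"
  proof (rule DERIV_pos_imp_increasing_open[OF assms(1), where f = "\<lambda>x. sin x - x * cos x"])
    fix y assume y: "0 < y" "y < x"
    have "((\<lambda>x. sin x - x * cos x) has_real_derivative y * sin y) (at y)"
      by (auto intro!: derivative_eq_intros)
    moreover have "y * sin y > 0" using y assms sin_gt_zero by simp
    ultimately show "\<exists>d. ((\<lambda>x. sin x - x * cos x) has_real_derivative d) (at y) \<and> d > 0"
      by blast
  qed (auto intro!: continuous_intros)
  then show ?thesis by simp
qed

text \<open>The function vanishes at 0, and with z = y / 2 its derivative at y is 4 cos z (sin z - z
  cos z), which is positive for 0 < z < pi / 2.\<close>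

lemma cos_ratio_num'_pos:
  assumes "0 < x" "x \<le> pi"
  shows "cos_ratio_num' x > 0"
proof -
  have "cos_ratio_num' 0 < cos_ratio_num' x"
  proof (rule DERIV_pos_imp_increasing_open[OF assms(1)])
    fix y assume y: "0 < y" "y < x"
    define z where "z = y / 2"
    have z: "0 < z" "z < pi / 2" "y = 2 * z" using y assms by (auto simp: z_def)
    have "2 * sin y - y * cos y - y = 4 * cos z * (sin z - z * cos z)"
      unfolding z(3) sin_double cos_double_cos by (simp add: power2_eq_square algebra_simps)
    moreover have "(cos_ratio_num' has_real_derivative 2 * sin y - y * cos y - y) (at y)"
      unfolding cos_ratio_num'_def [abs_def] by (auto intro!: derivative_eq_intros)
    ultimately have "(cos_ratio_num' has_real_derivative 4 * cos z * (sin z - z * cos z)) (at y)"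
      by simp
    moreover have "4 * cos z * (sin z - z * cos z) > 0"
      using z mult_cos_less_sin[of z] cos_gt_zero_pi[of z] by simp
    ultimately show "\<exists>d. (cos_ratio_num' has_real_derivative d) (at y) \<and> d > 0" by blast
  qed (auto intro!: continuous_intros simp: cos_ratio_num'_def [abs_def])
  then show ?thesis by (simp add: cos_ratio_num'_def)
qed

lemma cos_ratio_le_pi:
  assumes "0 < x" "x \<le> pi"
  shows "cos_ratio x \<le> cos_ratio pi"
proof (rule DERIV_nonneg_imp_nondecreasing[OF assms(2)])
  fix y assume y: "x \<le> y" "y \<le> pi"
  then have "y > 0" using assms by simp
  then show "\<exists>d. (cos_ratio has_real_derivative d) (at y) \<and> d \<ge> 0"
    using cos_ratio_deriv[of y] cos_ratio_num'_pos[of y] y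
    by (intro exI[of _ "cos_ratio_num' y / y ^ 4"]) auto
qed

text \<open>Compactness on [pi, R]: values on (0, pi] do not exceed \<open>cos_ratio pi\<close> by
  monotonicity, and R is chosen so that the bound 1 / (2 x) gives the same for x > R.\<close>

lemma cos_ratio_attains_max: "\<exists>z>0. \<forall>x>0. cos_ratio x \<le> cos_ratio z"
proof -
  have pos: "cos_ratio pi > 0"
    using power_strict_mono[of 3 pi 2] pi_gt3 by (simp add: cos_ratio_def)
  define R where "R = max pi (1 / (2 * cos_ratio pi))"
  have "continuous_on {pi..R} cos_ratio"
    using pi_gt_zero
    by (intro continuous_at_imp_continuous_on ballI DERIV_isCont[OF cos_ratio_deriv])
       (use less_le_trans[OF pi_gt_zero] in auto)
  moreover have "pi \<le> R" by (simp add: R_def)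
  ultimately obtain z where z: "z \<in> {pi..R}" "\<forall>x\<in>{pi..R}. cos_ratio x \<le> cos_ratio z"
    using continuous_attains_sup[of "{pi..R}" cos_ratio] by auto
  have z_pi: "cos_ratio pi \<le> cos_ratio z" using z \<open>pi \<le> R\<close> by auto
  have "cos_ratio x \<le> cos_ratio z" if "x > 0" for x
  proof -
    consider "x \<le> pi" | "x \<in> {pi..R}" | "x > R" by fastforce
    then show ?thesis
    proof cases
      case 1
      then show ?thesis using cos_ratio_le_pi[OF that] z_pi by simp
    next
      case 3
      then have "1 / (2 * cos_ratio pi) \<le> x" by (simp add: R_def)
      moreover have "cos_ratio x \<le> 1 / 2 / x"
        unfolding cos_ratio_eq[OF that]
        using cos_quot_nonneg[of x] that by (intro divide_right_mono) auto
      moreover have "1 / 2 / x \<le> cos_ratio pi"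
        using calculation(1) pos that by (simp add: field_simps)
      ultimately have "cos_ratio x \<le> cos_ratio pi" by linarith
      then show ?thesis using z_pi by simp
    qed (use z in auto)
  qed
  moreover have "z > 0" using z less_le_trans[OF pi_gt_zero] by auto
  ultimately show ?thesis by blast
qed

lemma M_const_max: "M_const > 0" "x > 0 \<Longrightarrow> cos_ratio x \<le> cos_ratio M_const"
proof -
  have "\<exists>z. is_arg_max cos_ratio (\<lambda>x. x \<in> {0<..}) z"
    using cos_ratio_attains_max by (auto simp: is_arg_max_linorder)
  then have "is_arg_max cos_ratio (\<lambda>x. x \<in> {0<..}) M_const"
    unfolding M_const_def arg_max_on_def arg_max_def by (rule someI_ex)
  then show "M_const > 0" "x > 0 \<Longrightarrow> cos_ratio x \<le> cos_ratio M_const"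
    by (auto simp: is_arg_max_linorder)
qed

lemma a_const_eq: "a_const = cos_ratio M_const"
  unfolding a_const_def using M_const_max by (intro cSup_eq_maximum) auto

text \<open>The derivative of \<open>cos_ratio\<close> vanishes at the maximizer but is positive on
  (0, pi]. From \<open>M_const\<close> up to 2 pi, \<open>cos_quot\<close> is therefore
  convex.\<close>

lemma M_const_gt_pi: "M_const > pi"
proof (rule ccontr)
  assume "\<not> M_const > pi"
  then have "cos_ratio_num' M_const > 0"
    using M_const_max(1) by (intro cos_ratio_num'_pos) auto
  moreover have "cos_ratio_num' M_const / M_const ^ 4 = 0"
    using cos_ratio_deriv[OF M_const_max(1)] M_const_max
    by (elim DERIV_local_max[where d = M_const]) auto
  ultimately show False using M_const_max(1) by simp
qed

lemma a_const_pos: "a_const > 0"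
proof -
  have "cos_ratio pi > 0"
    using power_strict_mono[of 3 pi 2] pi_gt3 by (simp add: cos_ratio_def)
  then show ?thesis using M_const_max(2)[of pi] by (simp add: a_const_eq)
qed

lemma line_le_cos_quot:
  assumes "x > 0"
  shows "1 / 2 - a_const * x \<le> cos_quot x"
  using M_const_max(2)[OF assms] assms
  by (simp add: cos_ratio_eq[OF assms] a_const_eq[symmetric] field_simps)

lemma line_eq_cos_quot_M: "1 / 2 - a_const * M_const = cos_quot M_const"
  using M_const_max(1) by (simp add: a_const_eq cos_ratio_eq)

text \<open>The line of slope \<open>- a_const\<close> stays below the graph and meets it at the
  interior point \<open>M_const\<close>, so it is the tangent there.\<close>

lemma cos_quot'_M: "cos_quot' M_const = - a_const"
proof -
  have "((\<lambda>x. cos_quot x + a_const * x) has_real_derivative cos_quot' M_const + a_const)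
      (at M_const)"
    using M_const_max(1) by (auto intro!: derivative_eq_intros cos_quot_deriv)
  then have "cos_quot' M_const + a_const = 0"
  proof (rule DERIV_local_min[OF _ M_const_max(1)], intro allI impI)
    fix y assume "\<bar>M_const - y\<bar> < M_const"
    then show "cos_quot M_const + a_const * M_const \<le> cos_quot y + a_const * y"
      using line_le_cos_quot[of y] line_eq_cos_quot_M by linarith
  qed
  then show ?thesis by simp
qed

section \<open>The profile \<open>psi\<close> of \<open>b_fun\<close>: supporting lines,
  monotonicity, scaling\<close>

text \<open>On the positive axis this is the greatest convex minorant of \<open>cos_quot\<close>.
  The properties of \<open>b_fun\<close> are read off from it through
  \<open>b_fun_eq_psi\<close>.\<close>

definition psi :: "real \<Rightarrow> real" where
  "psi \<theta> = (if \<theta> < M_const then 1 / 2 - a_const * \<theta>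
    else if \<theta> \<le> 2 * pi then cos_quot \<theta> else 0)"

lemma b_fun_eq_psi:
  assumes "\<gamma> > 0"
  shows "b_fun t \<gamma> = - 2 * t\<^sup>2 * psi (\<gamma> * \<bar>t\<bar>)"
proof (cases "t = 0")
  case False
  have "cos (\<gamma> * t) = cos (\<gamma> * \<bar>t\<bar>)" by (simp add: abs_if)
  then show ?thesis using assms False
    by (auto simp: b_fun_def psi_def cos_quot_def field_simps power2_eq_square power3_eq_cube)
qed (use M_const_max(1) in \<open>simp add: b_fun_def\<close>)

lemma psi_le_cos_quot: "\<theta> > 0 \<Longrightarrow> psi \<theta> \<le> cos_quot \<theta>"
  using line_le_cos_quot cos_quot_nonneg by (auto simp: psi_def)

lemma psi_nonneg: "psi \<theta> \<ge> 0"
proof (cases "\<theta> < M_const")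
  case True
  then have "a_const * \<theta> \<le> a_const * M_const" using a_const_pos by simp
  then show ?thesis using True line_eq_cos_quot_M cos_quot_nonneg[of M_const]
    by (simp add: psi_def)
qed (auto simp: psi_def cos_quot_nonneg)

text \<open>Each point of the graph of \<^const>\<open>psi\<close> lies on a nonincreasing line below \<^const>\<open>cos_quot\<close>: the
  tangent of \<^const>\<open>cos_quot\<close> at \<open>M\<close> if \<open>\<theta> < M\<close>, at \<open>\<theta>\<close> if \<open>M \<le> \<theta> \<le> 2 * pi\<close>, and the axis beyond.\<close>

lemma psi_support_line:
  obtains A C where "C \<ge> 0" "psi \<theta> = A - C * \<theta>" "\<And>x. x > 0 \<Longrightarrow> A - C * x \<le> cos_quot x"
proof -
  consider "\<theta> < M_const" | "M_const \<le> \<theta>" "\<theta> \<le> 2 * pi" | "M_const \<le> \<theta>" "\<theta> > 2 * pi" by linarith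
  then show ?thesis
  proof cases
    case 1
    then show ?thesis using a_const_pos line_le_cos_quot
      by (intro that[of a_const "1 / 2"]) (auto simp: psi_def)
  next
    case 2
    note M = M_const_gt_pi
    define s where "s = cos_quot' \<theta>"
    have tangent: "cos_quot \<theta> + s * (x - \<theta>) \<le> cos_quot x" if "pi \<le> x" "x \<le> 2 * pi" for x
      using cos_quot_above_tangent[of \<theta> x] that 2 M by (simp add: s_def)
    have at_2pi: "cos_quot (2 * pi) = 0" "cos_quot' (2 * pi) = 0"
      by (simp_all add: cos_quot_def cos_quot'_def)
    have s_nonpos: "s \<le> 0"
    proof (cases "\<theta> = 2 * pi")
      case False
      then have "s * (2 * pi - \<theta>) \<le> 0"
        using tangent[of "2 * pi"] at_2pi cos_quot_nonneg[of \<theta>] by simp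
      then show ?thesis using 2 False by (simp add: mult_le_0_iff)
    qed (simp add: s_def at_2pi)
    \<comment> \<open>By convexity the tangent at \<theta> is no steeper than the one at
      \<open>M_const\<close>. Left of \<open>M_const\<close> it therefore stays below
      \<open>1 / 2 - a_const * x\<close>, which is below \<open>cos_quot\<close>.\<close>
    have s_ge: "s \<ge> - a_const"
    proof (cases "\<theta> = M_const")
      case False
      have "- a_const * (\<theta> - M_const) \<le> cos_quot \<theta> - cos_quot M_const"
        using cos_quot_above_tangent[of M_const \<theta>] 2 M by (simp add: cos_quot'_M)
      also have "\<dots> \<le> s * (\<theta> - M_const)"
        using tangent[of M_const] 2 M by (simp add: algebra_simps)
      finally show ?thesis using 2 False by (subst (asm) mult_le_cancel_right) simp
    qed (simp add: s_def cos_quot'_M)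
    show ?thesis
    proof (rule that[of "- s" "cos_quot \<theta> - s * \<theta>"])
      fix x :: real assume x: "x > 0"
      consider "x \<le> M_const" | "M_const \<le> x" "x \<le> 2 * pi" | "2 * pi \<le> x" by linarith
      then have "cos_quot \<theta> + s * (x - \<theta>) \<le> cos_quot x"
      proof cases
        case 1
        then have "(s + a_const) * (x - M_const) \<le> 0"
          using s_ge by (intro mult_nonneg_nonpos) auto
        then show ?thesis
          using tangent[of M_const] line_le_cos_quot[OF x] line_eq_cos_quot_M 2 M
          by (simp add: algebra_simps)
      next
        case 3
        then have "s * (x - 2 * pi) \<le> 0" using s_nonpos by (intro mult_nonpos_nonneg) auto
        then show ?thesis
          using tangent[of "2 * pi"] at_2pi cos_quot_nonneg[of x]
          by (simp add: algebra_simps)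
      qed (use tangent M in auto)
      then show "cos_quot \<theta> - s * \<theta> - - s * x \<le> cos_quot x" by (simp add: algebra_simps)
    qed (use s_nonpos 2 in \<open>auto simp: psi_def\<close>)
  next
    case 3
    then show ?thesis using cos_quot_nonneg by (intro that[of 0 0]) (auto simp: psi_def)
  qed
qed

text \<open>The supporting line at y is nonincreasing and lies below \<open>cos_quot\<close>, so
  \<open>psi y\<close> is at most every value of \<open>cos_quot\<close> on (0, y]. Where
  \<open>psi x\<close> lies on the initial line instead, the comparison goes through
  \<open>M_const\<close> or is between two points of that line.\<close>

lemma psi_antimono:
  assumes "0 < x" "x \<le> y"
  shows "psi y \<le> psi x"
proof -
  obtain A C where C: "C \<ge> 0" "psi y = A - C * y" "\<And>z. z > 0 \<Longrightarrow> A - C * z \<le> cos_quot z"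
    using psi_support_line[of y] by metis
  have below: "psi y \<le> cos_quot z" if "0 < z" "z \<le> y" for z
    using C(2) C(3)[OF that(1)] mult_left_mono[OF that(2) C(1)] by linarith
  consider "y < M_const" | "x < M_const" "M_const \<le> y" | "M_const \<le> x" "x \<le> 2 * pi"
    | "M_const \<le> x" "2 * pi < x" by linarith
  then show ?thesis
  proof cases
    case 1
    then show ?thesis using assms a_const_pos by (simp add: psi_def)
  next
    case 2
    then have "a_const * x \<le> a_const * M_const" using a_const_pos by simp
    then show ?thesis
      using below[OF M_const_max(1) 2(2)] line_eq_cos_quot_M 2 by (simp add: psi_def)
  next
    case 3
    then show ?thesis using below[OF assms] by (simp add: psi_def)
  next
    case 4
    then show ?thesis using assms by (simp add: psi_def)
  qed
qed

lemma b_fun_nonpos: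
  assumes "\<gamma> > 0"
  shows "b_fun t \<gamma> \<le> 0"
  using psi_nonneg by (simp add: b_fun_eq_psi[OF assms])

lemma b_fun_mono:
  assumes "0 < \<gamma>" "\<gamma> \<le> \<gamma>'"
  shows "b_fun t \<gamma> \<le> b_fun t \<gamma>'"
proof (cases "t = 0")
  case False
  then have "psi (\<gamma>' * \<bar>t\<bar>) \<le> psi (\<gamma> * \<bar>t\<bar>)"
    using assms by (intro psi_antimono) auto
  then show ?thesis using assms by (simp add: b_fun_eq_psi mult_left_mono)
qed (use assms in \<open>simp add: b_fun_eq_psi\<close>)

text \<open>The product of the two arguments is unchanged, so only the factor t^2 scales. This
  reduces the sum of n variables to a single summand.\<close>

lemma b_fun_scale:
  assumes "\<gamma> > 0" "c > 0"
  shows "b_fun (t / c) (c * \<gamma>) = b_fun t \<gamma> / c\<^sup>2"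
  using assms by (simp add: b_fun_eq_psi power_divide)

text \<open>Equality would force \<open>cos \<theta> = - 1\<close> at a point \<open>\<theta> = \<gamma> * \<bar>t\<bar>\<close> where \<^const>\<open>psi\<close> touches \<^const>\<open>cos_quot\<close>.
  Below \<^const>\<open>M_const\<close> such a point maximizes \<^const>\<open>cos_ratio\<close>, so \<open>\<theta>\<^sup>2 = 12\<close>.
  Strictness matters because \<open>0 powr 0 = 0\<close> in the integrand of the theorem for \<open>n = 1\<close>.\<close>

lemma b_fun_gt_minus_one:
  assumes "\<gamma> \<ge> 2"
  shows "b_fun t \<gamma> > - 1"
proof (cases "t = 0")
  case False
  define \<theta> where "\<theta> = \<gamma> * \<bar>t\<bar>"
  have \<theta>: "\<theta> > 0" using False assms by (simp add: \<theta>_def)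
  have eq: "b_fun t \<gamma> = - 2 * (\<theta>\<^sup>2 * psi \<theta>) / \<gamma>\<^sup>2"
    using assms by (simp add: b_fun_eq_psi \<theta>_def power_mult_distrib)
  have bound: "\<theta>\<^sup>2 * psi \<theta> \<le> 1 - cos \<theta>"
    using mult_left_mono[OF psi_le_cos_quot[OF \<theta>], of "\<theta>\<^sup>2"] \<theta> by (simp add: cos_quot_def)
  have "\<theta>\<^sup>2 * psi \<theta> \<noteq> 2"
  proof
    assume eq2: "\<theta>\<^sup>2 * psi \<theta> = 2"
    then have cos: "cos \<theta> = - 1" using bound cos_ge_minus_one[of \<theta>] by linarith
    then have sin: "sin \<theta> = 0" using sin_cos_squared_add[of \<theta>] by simp
    \<comment> \<open>On (pi, 2 pi] the cosine exceeds -1, so locating \<theta> there gives the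
      contradiction.\<close>
    have "\<theta> \<le> 2 * pi \<and> pi < \<theta>"
    proof (cases "\<theta> < M_const")
      case True
      then have "cos \<theta> - 1 + \<theta>\<^sup>2 / 2 = a_const * \<theta> ^ 3"
        using eq2 cos by (simp add: psi_def power2_eq_square power3_eq_cube right_diff_distrib mult_ac)
      then have "cos_ratio \<theta> = cos_ratio M_const"
        using \<theta> unfolding a_const_eq[symmetric] by (simp add: cos_ratio_def)
      then have "cos_ratio_num' \<theta> / \<theta> ^ 4 = 0"
        using cos_ratio_deriv[OF \<theta>] M_const_max(2) \<theta>
        by (elim DERIV_local_max[where d = \<theta>]) auto
      then have "\<theta>\<^sup>2 = 12" using \<theta> by (simp add: cos_ratio_num'_def cos sin)
      moreover have "pi\<^sup>2 < 12" "12 < (2 * pi)\<^sup>2"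
        using power_mono[of pi "3.2" 2] power_strict_mono[of 6 "2 * pi" 2] pi_gt3 pi_approx
        by (auto simp: power2_eq_square)
      ultimately show ?thesis
        using \<theta> power2_less_imp_less[of pi \<theta>] power2_less_imp_less[of \<theta> "2 * pi"] by simp
    next
      case False
      then show ?thesis using eq2 M_const_gt_pi by (auto simp: psi_def split: if_splits)
    qed
    then have "cos (\<theta> - pi) < cos 0" by (intro cos_monotone_0_pi) auto
    then show False using cos by (simp add: cos_diff)
  qed
  moreover have "\<theta>\<^sup>2 * psi \<theta> \<le> 2" using bound cos_ge_minus_one[of \<theta>] by linarith
  ultimately have "\<theta>\<^sup>2 * psi \<theta> < 2" by simp
  moreover have "\<gamma>\<^sup>2 \<ge> 4" using power_mono[of 2 \<gamma> 2] assms by simp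
  ultimately show ?thesis using assms by (simp add: eq field_simps)
qed (use assms in \<open>simp add: b_fun_eq_psi\<close>)

subsection \<open>The characteristic function of a standardized distribution\<close>

lemma cmod_iexp_minus_one: "cmod (iexp w - 1) \<le> \<bar>w\<bar>"
  using iexp_approx1[of w 0] by simp

lemma cmod_iexp_minus_linear: "cmod (iexp w - 1 - \<i> * w) \<le> w\<^sup>2 / 2"
  using iexp_approx1[of w 1] by (simp add: power2_eq_square diff_diff_eq)

lemma abs_diff_cube_le:
  fixes x y :: real
  shows "\<bar>x - y\<bar> ^ 3 \<le> (\<bar>x\<bar> + \<bar>y\<bar>) * (x - y)\<^sup>2"
proof -
  have "\<bar>x - y\<bar> ^ 3 = \<bar>x - y\<bar> * (x - y)\<^sup>2"
    by (simp add: power3_eq_cube power2_eq_square flip: abs_mult)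
  also have "\<dots> \<le> (\<bar>x\<bar> + \<bar>y\<bar>) * (x - y)\<^sup>2"
    by (intro mult_right_mono) auto
  finally show ?thesis .
qed

text \<open>Up to normalization this is the difference between the two-point mean-zero average of
  \<open>iexp (u * _)\<close> over \<open>{x, y}\<close> and its uniform average over the interval between \<open>x\<close> and \<open>y\<close>.\<close>

definition iexp_gap :: "real \<Rightarrow> real \<Rightarrow> real \<Rightarrow> complex" where
  "iexp_gap u x y = u * (x * iexp (u * y) - y * iexp (u * x)) + \<i> * (iexp (u * x) - iexp (u * y))"

text \<open>For opposite signs the bracket on the right equals |x - y| (x^2 + y^2), and linear
  Taylor remainders at both points suffice. For equal signs it equals (x - y)^2 |x + y|; there the
  exponential at the point of smaller modulus is factored out, and |x - y| + 2 |y| = |x + y| when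
  |y| is the smaller modulus.\<close>

lemma iexp_gap_bound:
  "\<bar>x - y\<bar> * cmod (iexp_gap u x y)
    \<le> u\<^sup>2 / 2 * (\<bar>x\<bar> ^ 3 + \<bar>y\<bar> ^ 3 - x * y * (\<bar>x\<bar> + \<bar>y\<bar>))"
proof (cases "x * y \<le> 0")
  case True
  have "iexp_gap u x y = \<i> * iexp (u * y) * (iexp (u * x) - 1 - \<i> * (u * x))
      - \<i> * iexp (u * x) * (iexp (u * y) - 1 - \<i> * (u * y))"
    by (simp add: iexp_gap_def algebra_simps)
  also have "cmod \<dots> \<le> cmod (\<i> * iexp (u * y) * (iexp (u * x) - 1 - \<i> * (u * x)))
      + cmod (\<i> * iexp (u * x) * (iexp (u * y) - 1 - \<i> * (u * y)))"
    by (rule norm_triangle_ineq4)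
  also have "\<dots> \<le> (u * x)\<^sup>2 / 2 + (u * y)\<^sup>2 / 2"
    using cmod_iexp_minus_linear[of "u * x"] cmod_iexp_minus_linear[of "u * y"]
    by (intro add_mono) (simp_all add: norm_mult)
  finally have "\<bar>x - y\<bar> * cmod (iexp_gap u x y) \<le> \<bar>x - y\<bar> * ((u * x)\<^sup>2 / 2 + (u * y)\<^sup>2 / 2)"
    by (rule mult_left_mono) simp
  also have "\<dots> = u\<^sup>2 / 2 * (\<bar>x - y\<bar> * (x\<^sup>2 + y\<^sup>2))"
    by (simp add: power_mult_distrib algebra_simps)
  also have "\<bar>x - y\<bar> * (x\<^sup>2 + y\<^sup>2) = \<bar>x\<bar> ^ 3 + \<bar>y\<bar> ^ 3 - x * y * (\<bar>x\<bar> + \<bar>y\<bar>)"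
  proof -
    have "(x \<ge> 0 \<and> y \<le> 0) \<or> (x \<le> 0 \<and> y \<ge> 0)" using True by (simp add: mult_le_0_iff)
    then show ?thesis
      by (auto simp: power2_eq_square power3_eq_cube algebra_simps)
  qed
  finally show ?thesis .
next
  case False
  have ordered: "\<bar>x - y\<bar> * cmod (iexp_gap u x y)
      \<le> u\<^sup>2 / 2 * (\<bar>x\<bar> ^ 3 + \<bar>y\<bar> ^ 3 - x * y * (\<bar>x\<bar> + \<bar>y\<bar>))"
    if "x * y > 0" "\<bar>y\<bar> \<le> \<bar>x\<bar>" for x y
  proof -
    have "iexp (u * x) = iexp (u * y) * iexp (u * (x - y))"
      by (simp add: algebra_simps flip: exp_add)
    then have "iexp_gap u x y = iexp (u * y) *
        (\<i> * (iexp (u * (x - y)) - 1 - \<i> * (u * (x - y))) - u * y * (iexp (u * (x - y)) - 1))"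
      by (simp add: iexp_gap_def algebra_simps)
    also have "cmod \<dots> = cmod (\<i> * (iexp (u * (x - y)) - 1 - \<i> * (u * (x - y)))
        - u * y * (iexp (u * (x - y)) - 1))"
      by (simp add: norm_mult)
    also have "\<dots> \<le> cmod (\<i> * (iexp (u * (x - y)) - 1 - \<i> * (u * (x - y))))
        + cmod (u * y * (iexp (u * (x - y)) - 1))"
      by (rule norm_triangle_ineq4)
    also have "\<dots> \<le> (u * (x - y))\<^sup>2 / 2 + \<bar>u * y\<bar> * \<bar>u * (x - y)\<bar>"
    proof (rule add_mono)
      show "cmod (\<i> * (iexp (u * (x - y)) - 1 - \<i> * (u * (x - y)))) \<le> (u * (x - y))\<^sup>2 / 2"
        using cmod_iexp_minus_linear[of "u * (x - y)"] by (simp add: norm_mult)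
      have "cmod (u * y * (iexp (u * (x - y)) - 1)) = \<bar>u * y\<bar> * cmod (iexp (u * (x - y)) - 1)"
        by (simp add: norm_mult abs_mult)
      also have "\<dots> \<le> \<bar>u * y\<bar> * \<bar>u * (x - y)\<bar>"
        by (intro mult_left_mono cmod_iexp_minus_one) simp
      finally show "cmod (u * y * (iexp (u * (x - y)) - 1)) \<le> \<bar>u * y\<bar> * \<bar>u * (x - y)\<bar>" .
    qed
    also have "\<dots> = u\<^sup>2 / 2 * (\<bar>x - y\<bar> * \<bar>x + y\<bar>)"
    proof -
      have "\<bar>u\<bar> * \<bar>u\<bar> = u\<^sup>2" by (simp add: power2_eq_square)
      then have "\<bar>u * y\<bar> * \<bar>u * (x - y)\<bar> = u\<^sup>2 * (\<bar>y\<bar> * \<bar>x - y\<bar>)"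
        unfolding abs_mult by (metis mult.assoc mult.left_commute)
      moreover have "(u * (x - y))\<^sup>2 = u\<^sup>2 * (\<bar>x - y\<bar> * \<bar>x - y\<bar>)"
        by (simp add: power_mult_distrib power2_eq_square[of "x - y"])
      ultimately have "(u * (x - y))\<^sup>2 / 2 + \<bar>u * y\<bar> * \<bar>u * (x - y)\<bar>
          = u\<^sup>2 / 2 * (\<bar>x - y\<bar> * (\<bar>x - y\<bar> + 2 * \<bar>y\<bar>))"
        by (simp only:) (simp add: ring_distribs)
      also have "\<bar>x - y\<bar> + 2 * \<bar>y\<bar> = \<bar>x + y\<bar>"
        using that by (auto simp: zero_less_mult_iff)
      finally show ?thesis .
    qed
    finally have "\<bar>x - y\<bar> * cmod (iexp_gap u x y)
        \<le> \<bar>x - y\<bar> * (u\<^sup>2 / 2 * (\<bar>x - y\<bar> * \<bar>x + y\<bar>))"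
      by (rule mult_left_mono) simp
    also have "\<dots> = u\<^sup>2 / 2 * ((x - y)\<^sup>2 * \<bar>x + y\<bar>)"
      by (simp add: power2_eq_square)
    also have "(x - y)\<^sup>2 * \<bar>x + y\<bar> = \<bar>x\<bar> ^ 3 + \<bar>y\<bar> ^ 3 - x * y * (\<bar>x\<bar> + \<bar>y\<bar>)"
      using that by (auto simp: zero_less_mult_iff power2_eq_square power3_eq_cube algebra_simps)
    finally show ?thesis .
  qed
  have swap: "iexp_gap u y x = - iexp_gap u x y"
    by (simp add: iexp_gap_def algebra_simps)
  show ?thesis
  proof (cases "\<bar>y\<bar> \<le> \<bar>x\<bar>")
    case True
    then show ?thesis using False by (intro ordered) auto
  next
    case False
    then show ?thesis using ordered[of y x] \<open>\<not> x * y \<le> 0\<close>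
      by (simp add: swap abs_minus_commute ac_simps)
  qed
qed

section \<open>Moments of a standardized law\<close>

locale standardized_distribution = real_distribution +
  assumes integrable_abs_cube: "integrable M (\<lambda>x. \<bar>x\<bar> ^ 3)"
    and mean_zero: "expectation (\<lambda>x. x) = 0"
    and second_moment: "expectation (\<lambda>x. x\<^sup>2) = 1"
begin

abbreviation abs_moment3 :: real where
  "abs_moment3 \<equiv> expectation (\<lambda>x. \<bar>x\<bar> ^ 3)"

definition char' :: "real \<Rightarrow> complex" where
  "char' t = (CLINT x|M. \<i> * x * iexp (t * x))"

lemma integrable_le_cube:
  fixes f :: "real \<Rightarrow> 'b :: {banach, second_countable_topology}"
  assumes "f \<in> borel_measurable M" "\<And>x. norm (f x) \<le> 1 + \<bar>x\<bar> ^ 3"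
  shows "integrable M f"
  by (rule Bochner_Integration.integrable_bound[where f = "\<lambda>x. 1 + \<bar>x\<bar> ^ 3"])
     (use assms integrable_abs_cube in \<open>auto intro: order_trans\<close>)

lemma abs_le_one_plus_cube: "\<bar>x\<bar> \<le> 1 + \<bar>x\<bar> ^ 3" "x\<^sup>2 \<le> 1 + \<bar>x\<bar> ^ 3" for x :: real
proof -
  have "\<bar>x\<bar> \<le> 1 + \<bar>x\<bar> ^ 3 \<and> x\<^sup>2 \<le> 1 + \<bar>x\<bar> ^ 3"
  proof (cases "\<bar>x\<bar> \<le> 1")
    case True
    then have "x\<^sup>2 \<le> 1" using power_le_one[of "\<bar>x\<bar>" 2] by simp
    then show ?thesis using True by (simp add: add_increasing2)
  next
    case False
    then have "\<bar>x\<bar> ^ 1 \<le> \<bar>x\<bar> ^ 3" "\<bar>x\<bar> ^ 2 \<le> \<bar>x\<bar> ^ 3" by (intro power_increasing; simp)+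
    then show ?thesis by simp
  qed
  then show "\<bar>x\<bar> \<le> 1 + \<bar>x\<bar> ^ 3" "x\<^sup>2 \<le> 1 + \<bar>x\<bar> ^ 3" by auto
qed

lemma integrable_moments [simp]:
  "integrable M (\<lambda>x. x)" "integrable M (\<lambda>x. x\<^sup>2)" "integrable M (\<lambda>x. \<bar>x\<bar>)"
  "integrable M (\<lambda>x. x * \<bar>x\<bar>)" "integrable M (\<lambda>x. \<bar>x\<bar> ^ 3)"
  using integrable_abs_cube abs_le_one_plus_cube
  by (auto intro!: integrable_le_cube simp: abs_mult power2_eq_square)

lemma expectation_abs_le_one: "expectation (\<lambda>x. \<bar>x\<bar>) \<le> 1"
proof -
  have "\<bar>x\<bar> \<le> 1 / 2 + x\<^sup>2 / 2" for x :: real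
    using zero_le_power2[of "\<bar>x\<bar> - 1"] by (simp add: power2_eq_square algebra_simps)
  then have "expectation (\<lambda>x. \<bar>x\<bar>) \<le> expectation (\<lambda>x. 1 / 2 + x\<^sup>2 / 2)"
    by (intro integral_mono) auto
  also have "\<dots> = 1" using second_moment prob_space by simp
  finally show ?thesis .
qed

text \<open>Integrates (|x| - 1)^2 (2 |x| + 1) >= 0. Hence \<open>abs_moment3 + 1\<close> is at
  least 2, the range required by \<open>b_fun_gt_minus_one\<close>.\<close>

lemma abs_moment3_ge_one: "abs_moment3 \<ge> 1"
proof -
  have "3 * x\<^sup>2 - 1 \<le> 2 * \<bar>x\<bar> ^ 3" for x :: real
  proof -
    have "0 \<le> (\<bar>x\<bar> - 1)\<^sup>2 * (2 * \<bar>x\<bar> + 1)" by simp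
    also have "\<dots> = 2 * \<bar>x\<bar> ^ 3 - 3 * x\<^sup>2 + 1"
      by (simp add: power2_eq_square power3_eq_cube algebra_simps)
    finally show ?thesis by simp
  qed
  then have "expectation (\<lambda>x. 3 * x\<^sup>2 - 1) \<le> expectation (\<lambda>x. 2 * \<bar>x\<bar> ^ 3)"
    by (intro integral_mono) auto
  then show ?thesis using second_moment prob_space by simp
qed

text \<open>Two independent copies are modelled by iterated integrals over \<open>M\<close>. This
  normal form, with its complex counterpart \<open>expectation_iexp_poly\<close>, evaluates both the
  inner and the outer integral.\<close>

lemma expectation_abs_poly:
  defines "p \<equiv> \<lambda>c0 c1 c2 c3 c4 c5 y. c0 + c1 * y + c2 * y\<^sup>2 + c3 * \<bar>y\<bar> + c4 * (y * \<bar>y\<bar>)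
    + c5 * \<bar>y :: real\<bar> ^ 3"
  shows "integrable M (p c0 c1 c2 c3 c4 c5)"
    and "expectation (p c0 c1 c2 c3 c4 c5) = c0 + c2 + c3 * expectation (\<lambda>x. \<bar>x\<bar>)
      + c4 * expectation (\<lambda>x. x * \<bar>x\<bar>) + c5 * abs_moment3"
  unfolding p_def using mean_zero second_moment prob_space by simp_all

lemma integrable_iexp_moments [simp]:
  "integrable M (\<lambda>x. iexp (t * x))"
  "integrable M (\<lambda>x. x * iexp (t * x))"
  using abs_le_one_plus_cube by (auto intro!: integrable_le_cube simp: norm_mult)

lemma char'_eq: "char' t = \<i> * (CLINT x|M. x * iexp (t * x))"
  by (simp add: char'_def mult.assoc)

lemma expectation_iexp_poly:
  fixes t :: real
  defines "p \<equiv> \<lambda>c0 c1 c2 c3 c4 y. c0 + c1 * iexp (t * y) + c2 * (y * iexp (t * y))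
    + c3 * complex_of_real y + c4 * complex_of_real (y\<^sup>2)"
  shows "integrable M (p c0 c1 c2 c3 c4)"
    and "(CLINT y|M. p c0 c1 c2 c3 c4 y) = c0 + c1 * char M t - c2 * (\<i> * char' t) + c4"
proof -
  have [simp]: "integrable M (\<lambda>y. complex_of_real y)" "integrable M (\<lambda>y. complex_of_real (y\<^sup>2))"
    by (intro integrable_of_real; simp)+
  have [simp]: "(CLINT y|M. complex_of_real y) = 0" "(CLINT y|M. complex_of_real (y\<^sup>2)) = 1"
    "(CLINT y|M. c) = c" for c
    using mean_zero second_moment prob_space
    by (simp_all only: integral_complex_of_real lebesgue_integral_const) simp_all
  show "integrable M (p c0 c1 c2 c3 c4)"
    "(CLINT y|M. p c0 c1 c2 c3 c4 y) = c0 + c1 * char M t - c2 * (\<i> * char' t) + c4"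
    unfolding p_def
    by (simp_all add: char'_eq char_def del: of_real_power of_real_mult integral_complex_of_real
        lebesgue_integral_const)
qed

section \<open>Modulus and derivative of the characteristic function\<close>

lemma cmod_char_square:
  "(cmod (char M t))\<^sup>2 = expectation (\<lambda>x. expectation (\<lambda>y. cos (t * (x - y))))"
  "integrable M (\<lambda>x. expectation (\<lambda>y. cos (t * (x - y))))"
proof -
  define C where "C = expectation (\<lambda>x. cos (t * x))"
  define S where "S = expectation (\<lambda>x. sin (t * x))"
  have [simp]: "integrable M (\<lambda>x. cos (t * x))" "integrable M (\<lambda>x. sin (t * x))"
    by (auto intro!: integrable_const_bound[of _ 1])
  have "Re (CLINT x|M. iexp (t * x)) = C" "Im (CLINT x|M. iexp (t * x)) = S"
    unfolding C_def S_def integral_Re[OF integrable_iexp_moments(1), symmetric]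
      integral_Im[OF integrable_iexp_moments(1), symmetric]
    by (simp_all add: Re_exp Im_exp)
  then have "char M t = Complex C S"
    unfolding char_def by (simp add: complex_eq_iff del: of_real_mult)
  then have "(cmod (char M t))\<^sup>2 = C\<^sup>2 + S\<^sup>2" by (simp add: cmod_power2)
  moreover have inner: "expectation (\<lambda>y. cos (t * (x - y))) = cos (t * x) * C + sin (t * x) * S" for x
    by (simp add: right_diff_distrib cos_diff C_def S_def)
  moreover have "expectation (\<lambda>x. cos (t * x) * C + sin (t * x) * S) = C\<^sup>2 + S\<^sup>2"
    by (simp add: power2_eq_square C_def S_def)
  ultimately show "(cmod (char M t))\<^sup>2 = expectation (\<lambda>x. expectation (\<lambda>y. cos (t * (x - y))))"
    "integrable M (\<lambda>x. expectation (\<lambda>y. cos (t * (x - y))))"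
    by simp_all
qed

text \<open>The cosine bound is applied at t (x - y), with \<open>abs_diff_cube_le\<close> for the
  cubic term. Centering removes the mixed terms, leaving 2 for the quadratic part and 2
  (\<open>abs_moment3\<close> + E|X|) for the cubic one, where E|X| <= 1.\<close>

lemma cmod_char_square_le:
  assumes cos_le: "\<And>x. cos x \<le> 1 - A * x\<^sup>2 + C * \<bar>x\<bar> ^ 3" and "C \<ge> 0"
  shows "(cmod (char M t))\<^sup>2 \<le> 1 - 2 * A * t\<^sup>2 + 2 * C * (abs_moment3 + 1) * \<bar>t\<bar> ^ 3"
proof -
  define m where "m = expectation (\<lambda>x. \<bar>x\<bar>)"
  define s where "s = expectation (\<lambda>x. x * \<bar>x\<bar>)"
  define a where "a = A * t\<^sup>2"
  define c where "c = C * \<bar>t\<bar> ^ 3"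
  define F where "F x y = 1 - a * (x - y)\<^sup>2 + c * ((\<bar>x\<bar> + \<bar>y\<bar>) * (x - y)\<^sup>2)" for x y
  define G where "G x = 1 - a * x\<^sup>2 - a + c * (\<bar>x\<bar> * x\<^sup>2 + \<bar>x\<bar> + m * x\<^sup>2 - 2 * x * s + abs_moment3)" for x
  have c: "c \<ge> 0" using assms(2) by (simp add: c_def)
  have le: "cos (t * (x - y)) \<le> F x y" for x y
  proof -
    have "cos (t * (x - y)) \<le> 1 - A * (t * (x - y))\<^sup>2 + C * \<bar>t * (x - y)\<bar> ^ 3" by (rule cos_le)
    also have "\<dots> = 1 - a * (x - y)\<^sup>2 + c * \<bar>x - y\<bar> ^ 3"
      by (simp add: a_def c_def abs_mult power_mult_distrib)
    also have "\<dots> \<le> F x y"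
      unfolding F_def using c abs_diff_cube_le[of x y] by (intro add_left_mono mult_left_mono)
    finally show ?thesis .
  qed
  have cube: "\<bar>y\<bar> ^ 3 = \<bar>y\<bar> * y\<^sup>2" for y :: real
    by (simp add: power3_eq_cube power2_eq_square)
  have F: "F x = (\<lambda>y. (1 - a * x\<^sup>2 + c * (\<bar>x\<bar> * x\<^sup>2)) + (2 * a * x - 2 * c * \<bar>x\<bar> * x) * y
      + (c * \<bar>x\<bar> - a) * y\<^sup>2 + c * x\<^sup>2 * \<bar>y\<bar> + (- 2 * c * x) * (y * \<bar>y\<bar>) + c * \<bar>y\<bar> ^ 3)" for x
    by (rule ext) (simp add: F_def cube power2_eq_square algebra_simps)
  have F_int: "integrable M (F x)" "expectation (F x) = G x" for x
    unfolding F expectation_abs_poly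
    by (rule expectation_abs_poly) (simp add: G_def m_def s_def algebra_simps)
  have G: "G = (\<lambda>x. (1 - a + c * abs_moment3) + (- 2 * c * s) * x + (c * m - a) * x\<^sup>2 + c * \<bar>x\<bar>
      + 0 * (x * \<bar>x\<bar>) + c * \<bar>x\<bar> ^ 3)"
    by (rule ext) (simp add: G_def cube algebra_simps)
  have G_int: "integrable M G" "expectation G = 1 - 2 * a + 2 * c * (abs_moment3 + m)"
    unfolding G expectation_abs_poly
    by (rule expectation_abs_poly) (simp add: m_def algebra_simps)
  have "(cmod (char M t))\<^sup>2 \<le> expectation G"
    unfolding cmod_char_square
  proof (rule integral_mono[OF cmod_char_square(2) G_int(1)])
    fix x
    have "integrable M (\<lambda>y. cos (t * (x - y)))"
      by (auto intro!: integrable_const_bound[of _ 1])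
    then have "expectation (\<lambda>y. cos (t * (x - y))) \<le> expectation (F x)"
      by (rule integral_mono[OF _ F_int(1)]) (rule le)
    then show "expectation (\<lambda>y. cos (t * (x - y))) \<le> G x" by (simp add: F_int)
  qed
  also have "\<dots> \<le> 1 - 2 * a + 2 * c * (abs_moment3 + 1)"
    using expectation_abs_le_one c by (simp add: G_int m_def mult_left_mono)
  finally show ?thesis by (simp add: a_def c_def algebra_simps)
qed

text \<open>The linear Taylor remainder of \<open>iexp\<close> integrates to at most d^2 / 2 by the
  unit second moment, so the difference quotient is off by at most |d| / 2.\<close>

lemma char_has_vector_derivative: "(char M has_vector_derivative char' t) (at t)"
  unfolding has_vector_derivative_def
proof (rule has_derivativeI_sandwich[where e = 1 and H = "\<lambda>s. \<bar>s - t\<bar> / 2"])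
  show "((\<lambda>s. \<bar>s - t\<bar> / 2) \<longlongrightarrow> 0) (at t)"
    by (auto intro!: tendsto_eq_intros)
next
  fix s assume "s \<noteq> t"
  define d where "d = s - t"
  have pointwise: "cmod (iexp (s * x) - iexp (t * x) - d * (\<i> * x * iexp (t * x))) \<le> d\<^sup>2 / 2 * x\<^sup>2"
    for x
  proof -
    have "iexp (s * x) = iexp (t * x) * iexp (d * x)"
      by (simp add: d_def algebra_simps flip: exp_add)
    then have "iexp (s * x) - iexp (t * x) - d * (\<i> * x * iexp (t * x))
        = iexp (t * x) * (iexp (d * x) - 1 - \<i> * (d * x))"
      by (simp add: algebra_simps)
    then show ?thesis using cmod_iexp_minus_linear[of "d * x"]
      by (simp add: norm_mult power_mult_distrib)
  qed
  have "char M s - char M t - (s - t) *\<^sub>R char' t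
      = (CLINT x|M. iexp (s * x) - iexp (t * x) - d * (\<i> * x * iexp (t * x)))"
    by (simp add: char_def char'_def d_def scaleR_conv_of_real mult.assoc del: of_real_mult of_real_diff)
  also have "cmod \<dots> \<le> expectation (\<lambda>x. d\<^sup>2 / 2 * x\<^sup>2)"
    by (rule Bochner_Integration.integral_norm_bound_integral) (use pointwise in \<open>auto simp: mult.assoc simp del: of_real_mult\<close>)
  also have "\<dots> = d\<^sup>2 / 2" by (simp add: second_moment)
  finally show "cmod (char M s - char M t - (s - t) *\<^sub>R char' t) / norm (s - t) \<le> \<bar>s - t\<bar> / 2"
    using \<open>s \<noteq> t\<close> by (simp add: d_def power2_eq_square divide_simps)
qed (auto intro: bounded_linear_scaleR_left)

text \<open>This is \<open>t\<close> times the difference between the characteristic functions of \<open>M\<close> and of its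
  zero-bias transform. Averaging \<^const>\<open>iexp_gap\<close> over two independent copies gives the sharp
  constant \<open>1 / 2\<close>.\<close>

lemma cmod_char'_plus_le: "cmod (char' t + t * char M t) \<le> abs_moment3 * t\<^sup>2 / 2"
proof -
  define K where "K x y = (x - y) * iexp_gap t x y" for x y
  define L where "L x = t * (x\<^sup>2 * char M t + x * (\<i> * char' t) + iexp (t * x))
    + \<i> * (x * iexp (t * x) - x * char M t - \<i> * char' t)" for x :: real
  define B where "B x y = t\<^sup>2 / 2 * (\<bar>x\<bar> ^ 3 + \<bar>y\<bar> ^ 3 - x * y * (\<bar>x\<bar> + \<bar>y\<bar>))" for x y
  define s where "s = expectation (\<lambda>x. x * \<bar>x\<bar>)"
  define D where "D x = t\<^sup>2 / 2 * (\<bar>x\<bar> ^ 3 + abs_moment3 - x * s)" for x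
  have K: "K x = (\<lambda>y. \<i> * (x * iexp (t * x)) + (t * x\<^sup>2 - \<i> * x) * iexp (t * y)
      + (\<i> - t * x) * (y * iexp (t * y)) + (- t * x * iexp (t * x) - \<i> * iexp (t * x)) * y
      + t * iexp (t * x) * complex_of_real (y\<^sup>2))" for x
    by (rule ext) (simp add: K_def iexp_gap_def power2_eq_square algebra_simps)
  have K_int: "integrable M (K x)" "(CLINT y|M. K x y) = L x" for x
    unfolding K expectation_iexp_poly
    by (rule expectation_iexp_poly) (simp add: L_def algebra_simps)
  have L: "L = (\<lambda>x. char' t + t * iexp (t * x) + \<i> * (x * iexp (t * x))
      + (t * (\<i> * char' t) - \<i> * char M t) * x + (t * char M t) * complex_of_real (x\<^sup>2))"
    by (rule ext) (simp add: L_def algebra_simps)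
  have L_int: "integrable M L" "(CLINT x|M. L x) = 2 * (char' t + t * char M t)"
    unfolding L expectation_iexp_poly
    by (rule expectation_iexp_poly) (simp add: algebra_simps)
  have B: "B x = (\<lambda>y. t\<^sup>2 / 2 * \<bar>x\<bar> ^ 3 + (- (t\<^sup>2 / 2) * (x * \<bar>x\<bar>)) * y + 0 * y\<^sup>2 + 0 * \<bar>y\<bar>
      + (- (t\<^sup>2 / 2) * x) * (y * \<bar>y\<bar>) + t\<^sup>2 / 2 * \<bar>y\<bar> ^ 3)" for x
    by (rule ext) (simp add: B_def algebra_simps)
  have B_int: "integrable M (B x)" "expectation (B x) = D x" for x
    unfolding B expectation_abs_poly
    by (rule expectation_abs_poly) (simp add: D_def s_def algebra_simps)
  have D: "D = (\<lambda>x. t\<^sup>2 / 2 * abs_moment3 + (- (t\<^sup>2 / 2) * s) * x + 0 * x\<^sup>2 + 0 * \<bar>x\<bar>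
      + 0 * (x * \<bar>x\<bar>) + t\<^sup>2 / 2 * \<bar>x\<bar> ^ 3)"
    by (rule ext) (simp add: D_def algebra_simps)
  have D_int: "integrable M D" "expectation D = t\<^sup>2 * abs_moment3"
    unfolding D expectation_abs_poly
    by (rule expectation_abs_poly) (simp add: algebra_simps)
  \<comment> \<open>\<open>L\<close> and \<open>D\<close> are the integrals of \<open>K\<close> and
    \<open>B\<close> over the second variable. The norm bound is used once per variable, and the
    factor 2 in the integral of \<open>L\<close> produces the constant 1/2.\<close>
  have "cmod (L x) \<le> D x" for x
    unfolding K_int(2)[symmetric] B_int(2)[symmetric]
  proof (rule Bochner_Integration.integral_norm_bound_integral[OF K_int(1) B_int(1)])
    fix y
    show "cmod (K x y) \<le> B x y"
      using iexp_gap_bound[of x y t] by (simp add: K_def B_def norm_mult flip: of_real_diff)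
  qed
  then have "cmod (CLINT x|M. L x) \<le> expectation D"
    by (intro Bochner_Integration.integral_norm_bound_integral[OF L_int(1) D_int(1)])
  then show ?thesis unfolding L_int D_int norm_mult by (simp add: mult.commute)
qed

end

subsection \<open>Sums of independent copies\<close>

text \<open>Strict positivity of B matters for k = 0: the left side is then 1, while
  \<open>0 powr 0 = 0\<close>.\<close>

lemma power_le_powr_half:
  fixes x B :: real
  assumes "0 \<le> x" "x\<^sup>2 \<le> B" "0 < B"
  shows "x ^ k \<le> B powr (real k / 2)"
proof -
  have "x \<le> B powr (1 / 2)"
    using assms by (simp add: powr_half_sqrt real_le_rsqrt)
  then have "x ^ k \<le> (B powr (1 / 2)) ^ k" using assms by (intro power_mono) auto
  also have "\<dots> = B powr (real k / 2)" using assms by (simp add: powr_power)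
  finally show ?thesis .
qed

lemma b_fun_measurable [measurable]: "(\<lambda>t. b_fun t \<gamma>) \<in> borel_measurable borel"
  unfolding b_fun_def by measurable

context standardized_distribution
begin

text \<open>The supporting line is chosen for each t at \<gamma> |t|. There the cubic bound
  collapses to 1 - 2 t^2 (A - C \<gamma> |t|), whose bracket is the value of
  \<open>psi\<close>.\<close>

lemma cmod_char_square_le_b_fun: "(cmod (char M t))\<^sup>2 \<le> 1 + b_fun t (abs_moment3 + 1)"
proof -
  define \<gamma> where "\<gamma> = abs_moment3 + 1"
  have "\<gamma> > 0" using abs_moment3_ge_one by (simp add: \<gamma>_def)
  obtain A C where C: "C \<ge> 0" and psi: "psi (\<gamma> * \<bar>t\<bar>) = A - C * (\<gamma> * \<bar>t\<bar>)"
    and line: "\<And>x. x > 0 \<Longrightarrow> A - C * x \<le> cos_quot x"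
    using psi_support_line[of "\<gamma> * \<bar>t\<bar>"] by metis
  have cos_le: "cos x \<le> 1 - A * x\<^sup>2 + C * \<bar>x\<bar> ^ 3" for x
  proof (cases "x = 0")
    case False
    then have "x\<^sup>2 * (A - C * \<bar>x\<bar>) \<le> x\<^sup>2 * cos_quot \<bar>x\<bar>"
      by (intro mult_left_mono line) auto
    also have "\<dots> = 1 - cos x" using False by (simp add: cos_quot_def)
    finally show ?thesis by (simp add: power3_eq_cube power2_eq_square algebra_simps)
  qed simp
  have "(cmod (char M t))\<^sup>2 \<le> 1 - 2 * A * t\<^sup>2 + 2 * C * \<gamma> * \<bar>t\<bar> ^ 3"
    unfolding \<gamma>_def using cos_le C by (rule cmod_char_square_le)
  also have "\<dots> = 1 + b_fun t \<gamma>"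
    using \<open>\<gamma> > 0\<close>
    by (simp add: b_fun_eq_psi psi power2_eq_square power3_eq_cube algebra_simps)
  finally show ?thesis by (simp add: \<gamma>_def)
qed

lemma scaled_b_fun:
  fixes n :: nat
  assumes "n \<ge> 1"
  shows "b_fun t (abs_moment3 / sqrt n + 1 / sqrt n) / n = b_fun (t / sqrt n) (abs_moment3 + 1)"
    and "1 + b_fun t (abs_moment3 / sqrt n + 1 / sqrt n) / n > 0"
    and "1 + b_fun t (abs_moment3 / sqrt n + 1 / sqrt n) / n \<le> 1"
proof -
  have \<gamma>: "abs_moment3 / sqrt n + 1 / sqrt n > 0"
    using assms abs_moment3_ge_one by (simp flip: add_divide_distrib)
  have "sqrt n * (abs_moment3 / sqrt n + 1 / sqrt n) = abs_moment3 + 1"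
    using assms by (simp add: field_simps)
  then show eq: "b_fun t (abs_moment3 / sqrt n + 1 / sqrt n) / n = b_fun (t / sqrt n) (abs_moment3 + 1)"
    using b_fun_scale[OF \<gamma>, of "sqrt n" t] assms by simp
  show "1 + b_fun t (abs_moment3 / sqrt n + 1 / sqrt n) / n > 0"
    unfolding eq using b_fun_gt_minus_one[of "abs_moment3 + 1" "t / sqrt n"] abs_moment3_ge_one by simp
  show "1 + b_fun t (abs_moment3 / sqrt n + 1 / sqrt n) / n \<le> 1"
    unfolding eq using b_fun_nonpos[of "abs_moment3 + 1" "t / sqrt n"] abs_moment3_ge_one by simp
qed

lemma cmod_char_power_le:
  fixes n k :: nat
  assumes "n \<ge> 1"
  shows "cmod (char M (t / sqrt n)) ^ k
    \<le> (1 + b_fun t (abs_moment3 / sqrt n + 1 / sqrt n) / n) powr (k / 2)"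
  using scaled_b_fun[OF assms, of t] cmod_char_square_le_b_fun[of "t / sqrt n"]
  by (intro power_le_powr_half) auto

text \<open>Passing from \<open>n\<close> to \<open>m \<le> n\<close> uses that \<^const>\<open>b_fun\<close> is nonpositive and increases with its
  second argument.\<close>

lemma scaled_b_fun_powr_le:
  fixes m n k :: nat
  assumes "m \<ge> 1" "n \<ge> m" "r \<le> k / n" "r \<ge> 0"
  shows "(1 + b_fun t (abs_moment3 / sqrt n + 1 / sqrt n) / n) powr (k / 2)
    \<le> exp (r / 2 * b_fun t (abs_moment3 / sqrt n + 1 / sqrt m))"
proof -
  define b where "b = b_fun t (abs_moment3 / sqrt n + 1 / sqrt n)"
  have n: "n \<ge> 1" using assms by simp
  have \<gamma>: "abs_moment3 / sqrt n + 1 / sqrt n > 0"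
    using n abs_moment3_ge_one by (simp flip: add_divide_distrib)
  have pos: "1 + b / n > 0" using scaled_b_fun(2)[OF n] by (simp add: b_def)
  have "(1 + b / n) powr (k / 2) = exp (k / 2 * ln (1 + b / n))"
    using pos by (simp add: powr_def)
  also have "\<dots> \<le> exp (k / 2 * (b / n))"
    unfolding exp_le_cancel_iff using ln_le_minus_one[OF pos] by (intro mult_left_mono) auto
  also have "k / 2 * (b / n) = b * (k / n) / 2" by (simp add: mult.commute)
  also have "exp \<dots> \<le> exp (b * r / 2)"
    using assms b_fun_nonpos[OF \<gamma>, of t] mult_left_mono_neg[of r "k / n" b] by (simp add: b_def)
  also have "\<dots> \<le> exp (r / 2 * b_fun t (abs_moment3 / sqrt n + 1 / sqrt m))"
  proof -
    have "b \<le> b_fun t (abs_moment3 / sqrt n + 1 / sqrt m)"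
      unfolding b_def using assms \<gamma> by (intro b_fun_mono) (auto simp: frac_le)
    from mult_left_mono[OF this assms(4)] show ?thesis by (simp add: mult.commute)
  qed
  finally show ?thesis by (simp add: b_def)
qed

lemma char_minus: "char M (- t) = cnj (char M t)"
  unfolding char_def Bochner_Integration.integral_cnj[symmetric] by (simp add: exp_cnj)

text \<open>The integrating factor \<open>exp (s\<^sup>2 / 2)\<close> turns \<open>cmod_char'_plus_le\<close> into a bound for the
  derivative of the quotient of the two characteristic functions.\<close>

lemma cmod_char_power_minus_normal_le:
  fixes w :: "real \<Rightarrow> real"
  assumes n: "n \<ge> 1"
    and w: "\<And>s. cmod (char M (s / sqrt n)) ^ (n - 1) \<le> w s" "\<And>s. w s \<le> 1"
    and [measurable]: "w \<in> borel_measurable borel"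
  shows "cmod (char M (t / sqrt n) ^ n - normal_cf t)
    \<le> abs_moment3 / sqrt n * normal_cf t * (LBINT s:{0..\<bar>t\<bar>}. w s * (s\<^sup>2 / 2) * exp (s\<^sup>2 / 2))"
proof -
  define f where "f s = char M (s / sqrt n)" for s
  define D where "D s = f s ^ n * of_real (exp (s\<^sup>2 / 2))" for s
  \<comment> \<open>The product rule, with n / sqrt n = sqrt n and s = sqrt n * (s / sqrt n),
    exposes the quantity bounded by \<open>cmod_char'_plus_le\<close> at s / sqrt n.\<close>
  define D' where "D' s = of_real (sqrt n * exp (s\<^sup>2 / 2)) * f s ^ (n - 1)
    * (char' (s / sqrt n) + of_real (s / sqrt n) * f s)" for s
  define h where "h s = w s * (s\<^sup>2 / 2) * exp (s\<^sup>2 / 2)" for s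
  have w_nonneg: "w s \<ge> 0" for s using order_trans[OF _ w(1)] by simp
  have deriv: "(D has_vector_derivative D' s) (at s)" for s
  proof -
    have "((\<lambda>s. s / sqrt n) has_vector_derivative 1 / sqrt n) (at s)"
      by (auto intro!: derivative_eq_intros)
    then have "(f has_vector_derivative (1 / sqrt n) *\<^sub>R char' (s / sqrt n)) (at s)"
      unfolding f_def [abs_def]
      using vector_diff_chain_at[OF _ char_has_vector_derivative] by (simp add: o_def)
    moreover have "((\<lambda>z. z ^ n) has_field_derivative of_nat n * f s ^ (n - 1)) (at (f s))"
      by (auto intro!: derivative_eq_intros)
    ultimately have "((\<lambda>z. z ^ n) \<circ> f has_vector_derivative
        (1 / sqrt n) *\<^sub>R char' (s / sqrt n) * (of_nat n * f s ^ (n - 1))) (at s)"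
      by (rule field_vector_diff_chain_at)
    then have "((\<lambda>s. f s ^ n) has_vector_derivative
        (1 / sqrt n) *\<^sub>R char' (s / sqrt n) * (of_nat n * f s ^ (n - 1))) (at s)"
      by (simp only: o_def)
    moreover have "((\<lambda>s. complex_of_real (exp (s\<^sup>2 / 2))) has_vector_derivative
        of_real (exp (s\<^sup>2 / 2) * s)) (at s)"
      by (auto intro!: derivative_eq_intros has_vector_derivative_of_real
          simp flip: has_real_derivative_iff_has_vector_derivative)
    ultimately have "(D has_vector_derivative
        f s ^ n * of_real (exp (s\<^sup>2 / 2) * s)
        + (1 / sqrt n) *\<^sub>R char' (s / sqrt n) * (of_nat n * f s ^ (n - 1))
          * of_real (exp (s\<^sup>2 / 2))) (at s)"
      unfolding D_def [abs_def] by (rule has_vector_derivative_mult)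
    also have "f s ^ n * of_real (exp (s\<^sup>2 / 2) * s)
        + (1 / sqrt n) *\<^sub>R char' (s / sqrt n) * (of_nat n * f s ^ (n - 1))
          * of_real (exp (s\<^sup>2 / 2)) = D' s"
    proof -
      have "complex_of_nat n = complex_of_real (sqrt n) * complex_of_real (sqrt n)"
        by (simp flip: of_real_mult)
      moreover have "f s ^ n = f s * f s ^ (n - 1)" using n by (cases n) auto
      moreover have "complex_of_real (sqrt n) \<noteq> 0" using n by simp
      ultimately show ?thesis
        by (simp add: D'_def scaleR_conv_of_real field_simps)
    qed
    finally show ?thesis .
  qed
  have D'_le: "cmod (D' s) \<le> abs_moment3 / sqrt n * h s" for s
  proof -
    have "cmod (D' s) = sqrt n * exp (s\<^sup>2 / 2) * (cmod (f s) ^ (n - 1)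
        * cmod (char' (s / sqrt n) + of_real (s / sqrt n) * f s))"
      by (simp add: D'_def norm_mult norm_power mult.assoc del: of_real_mult)
    also have "\<dots> \<le> sqrt n * exp (s\<^sup>2 / 2) * (w s * (abs_moment3 * (s / sqrt n)\<^sup>2 / 2))"
      using w(1)[of s] w_nonneg[of s] cmod_char'_plus_le[of "s / sqrt n"]
      by (intro mult_left_mono mult_mono) (auto simp: f_def)
    also have "\<dots> = abs_moment3 / sqrt n * h s"
      using n by (simp add: h_def power2_eq_square field_simps)
    finally show ?thesis .
  qed
  have bound: "cmod (f t ^ n - normal_cf t)
      \<le> abs_moment3 / sqrt n * normal_cf t * (LBINT s:{0..t}. h s)" if "t \<ge> 0" for t
  proof -
    have D'_int: "(D' has_integral (D t - D 0)) {0..t}"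
      by (rule fundamental_theorem_of_calculus[OF that has_vector_derivative_at_within[OF deriv]])
    \<comment> \<open>The bound \<open>w s \<le> 1\<close> dominates h by a continuous function.
      This ties the Lebesgue integral of the statement to the gauge integral from the fundamental
      theorem.\<close>
    have h_int: "set_integrable lborel {0..t} h"
    proof (rule set_integrable_bound)
      show "set_integrable lborel {0..t} (\<lambda>s. s\<^sup>2 / 2 * exp (s\<^sup>2 / 2) :: real)"
        by (intro borel_integrable_atLeastAtMost' continuous_intros) auto
      show "set_borel_measurable lborel {0..t} h"
        unfolding set_borel_measurable_def h_def by measurable
      show "AE s in lborel. s \<in> {0..t} \<longrightarrow> norm (h s) \<le> norm (s\<^sup>2 / 2 * exp (s\<^sup>2 / 2))"
      proof (intro AE_I2 impI)
        fix s
        have "norm (h s) = w s * (s\<^sup>2 / 2 * exp (s\<^sup>2 / 2))"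
          using w_nonneg[of s] by (simp add: h_def abs_mult)
        also have "\<dots> \<le> s\<^sup>2 / 2 * exp (s\<^sup>2 / 2)"
          using w_nonneg[of s] w(2)[of s] by (intro mult_left_le_one_le) auto
        finally show "norm (h s) \<le> norm (s\<^sup>2 / 2 * exp (s\<^sup>2 / 2))" by simp
      qed
    qed
    have "cmod (D t - D 0) \<le> integral {0..t} (\<lambda>s. abs_moment3 / sqrt n * h s)"
      unfolding integral_unique[OF D'_int, symmetric]
      using D'_int set_borel_integral_eq_integral(1)[OF h_int] D'_le
      by (intro Henstock_Kurzweil_Integration.integral_norm_bound_integral integrable_on_mult_right)
         auto
    also have "\<dots> = abs_moment3 / sqrt n * (LBINT s:{0..t}. h s)"
      by (simp add: set_borel_integral_eq_integral(2)[OF h_int])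
    finally have "normal_cf t * cmod (D t - D 0)
        \<le> normal_cf t * (abs_moment3 / sqrt n * (LBINT s:{0..t}. h s))"
      by (intro mult_left_mono) (auto simp: normal_cf_def)
    moreover have "f t ^ n - normal_cf t = normal_cf t * (D t - D 0)"
    proof -
      have "D 0 = 1" by (simp add: D_def f_def char_zero)
      moreover have "normal_cf t * D t = f t ^ n"
        by (simp add: D_def normal_cf_def exp_minus)
      ultimately show ?thesis by (simp add: algebra_simps)
    qed
    ultimately show ?thesis by (simp add: norm_mult normal_cf_def mult_ac)
  qed
  \<comment> \<open>For negative t the difference is the complex conjugate of the one at -t.\<close>
  have "cmod (f t ^ n - normal_cf t) = cmod (f \<bar>t\<bar> ^ n - normal_cf \<bar>t\<bar>)"
  proof (cases "t \<ge> 0")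
    case False
    have "f t ^ n - normal_cf t = cnj (f (- t) ^ n - normal_cf (- t))"
      using char_minus[of "- t / sqrt n"] by (simp add: f_def normal_cf_def)
    then show ?thesis using False by (simp only: complex_mod_cnj)
  qed simp
  also have "\<dots> \<le> abs_moment3 / sqrt n * normal_cf \<bar>t\<bar> * (LBINT s:{0..\<bar>t\<bar>}. h s)"
    by (intro bound) simp
  finally show ?thesis by (simp add: f_def h_def normal_cf_def)
qed

end

section \<open>Transfer from the common law to normalized sums\<close>

theorem theorem6:
  fixes P :: "'a measure" and X :: "nat \<Rightarrow> 'a \<Rightarrow> real"
  assumes "prob_space P"
    and indep: "prob_space.indep_vars P (\<lambda>_. borel) X {1..}"
    and ident: "\<And>i. i \<ge> 1 \<Longrightarrow> distr P borel (X i) = distr P borel (X 1)"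
    and third_moment: "integrable P (\<lambda>\<omega>. \<bar>X 1 \<omega>\<bar> ^ 3)"
    and centered: "prob_space.expectation P (X 1) = 0"
    and unit_variance: "prob_space.variance P (X 1) = 1"
  shows "(\<forall>(n::nat) (t::real). n \<ge> 1 \<longrightarrow>
      cmod (sum_cf P X n t)
        \<le> (1 + b_fun t (lyapunov_fraction P X n + 1 / sqrt (real n)) / real n) powr (real n / 2)) \<and>
    (\<forall>(n::nat) (t::real). n \<ge> 1 \<longrightarrow>
      cf_dist P X n t
        \<le> lyapunov_fraction P X n * normal_cf t *
          (LBINT s:{0..\<bar>t\<bar>}.
            (1 + b_fun s (lyapunov_fraction P X n + 1 / sqrt (real n)) / real n)
              powr ((real n - 1) / 2) * (s\<^sup>2 / 2) * exp (s\<^sup>2 / 2))) \<and>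
    (\<forall>(m::nat) (n::nat) (t::real). m \<ge> 1 \<and> n \<ge> m \<longrightarrow>
      cmod (sum_cf P X n t)
        \<le> exp (1 / 2 * b_fun t (lyapunov_fraction P X n + 1 / sqrt (real m)))) \<and>
    (\<forall>(m::nat) (n::nat) (t::real). m \<ge> 1 \<and> n \<ge> m \<longrightarrow>
      cf_dist P X n t
        \<le> lyapunov_fraction P X n * normal_cf t *
          (LBINT s:{0..\<bar>t\<bar>}.
            exp ((real m - 1) / (2 * real m) * b_fun s (lyapunov_fraction P X n + 1 / sqrt (real m))
                 + s\<^sup>2 / 2) * (s\<^sup>2 / 2)))"
proof -
  interpret P: prob_space P by fact
  have X [measurable]: "X i \<in> borel_measurable P" if "i \<ge> 1" for i
    using indep that by (simp add: P.indep_vars_def)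
  note [measurable] = X[of 1, simplified]
  define M where "M = distr P borel (X 1)"
  interpret M: real_distribution M
    unfolding M_def by (rule P.real_distribution_distr) simp
  interpret M: standardized_distribution M
  proof
    show "integrable M (\<lambda>x. \<bar>x\<bar> ^ 3)" using third_moment by (simp add: M_def integrable_distr_eq)
    show "M.expectation (\<lambda>x. x) = 0" using centered by (simp add: M_def integral_distr)
    show "M.expectation (\<lambda>x. x\<^sup>2) = 1" using unit_variance centered by (simp add: M_def integral_distr)
  qed
  have lyapunov: "lyapunov_fraction P X n = M.abs_moment3 / sqrt n" for n
    by (simp add: lyapunov_fraction_def M_def integral_distr)
  have cf: "sum_cf P X n t = char M (t / sqrt n) ^ n" for n t
  proof -
    have [measurable]: "X i \<in> borel_measurable P" if "i \<in> {1..n}" for i using X that by simp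
    have "sum_cf P X n t = char (distr P borel (\<lambda>\<omega>. \<Sum>i\<in>{1..n}. X i \<omega>)) (t / sqrt n)"
      by (simp add: sum_cf_def char_def normalized_sum_def [abs_def] integral_distr)
    also have "\<dots> = (\<Prod>i\<in>{1..n}. char (distr P borel (X i)) (t / sqrt n))"
      by (intro P.char_distr_sum P.indep_vars_subset[OF indep]) auto
    also have "\<dots> = (\<Prod>i\<in>{1..n}. char M (t / sqrt n))"
    proof (rule prod.cong[OF refl])
      fix i assume "i \<in> {1..n}"
      then have "distr P borel (X i) = M" unfolding M_def by (intro ident) simp
      then show "char (distr P borel (X i)) (t / sqrt n) = char M (t / sqrt n)" by simp
    qed
    finally show ?thesis by simp
  qed
  have dist: "cf_dist P X n t = cmod (char M (t / sqrt n) ^ n - normal_cf t)" for n t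
    by (simp add: cf_dist_def cf)
  have pred_le: "cmod (char M (s / sqrt n)) ^ (n - 1)
      \<le> (1 + b_fun s (M.abs_moment3 / sqrt n + 1 / sqrt n) / n) powr ((real n - 1) / 2)"
    if "n \<ge> 1" for n s
    using M.cmod_char_power_le[OF that, of s "n - 1"] that by (simp add: of_nat_diff)
  show ?thesis
    unfolding lyapunov dist
  proof (intro conjI allI impI; (elim conjE)?)
    fix n :: nat and t :: real
    assume n: "n \<ge> 1"
    show "cmod (sum_cf P X n t)
        \<le> (1 + b_fun t (M.abs_moment3 / sqrt n + 1 / sqrt n) / n) powr (n / 2)"
      unfolding cf norm_power by (rule M.cmod_char_power_le[OF n])
    show "cmod (char M (t / sqrt n) ^ n - normal_cf t) \<le> M.abs_moment3 / sqrt n * normal_cf t *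
        (LBINT s:{0..\<bar>t\<bar>}. (1 + b_fun s (M.abs_moment3 / sqrt n + 1 / sqrt n) / n)
          powr ((real n - 1) / 2) * (s\<^sup>2 / 2) * exp (s\<^sup>2 / 2))"
    proof (rule M.cmod_char_power_minus_normal_le[OF n pred_le[OF n]])
      show "(1 + b_fun s (M.abs_moment3 / sqrt n + 1 / sqrt n) / n) powr ((real n - 1) / 2) \<le> 1"
        for s
        using M.scaled_b_fun(2,3)[OF n, of s] n by (intro powr_le1) auto
    qed measurable
  next
    fix m n :: nat and t :: real
    assume m: "m \<ge> 1" "m \<le> n"
    then have n: "n \<ge> 1" by simp
    have "cmod (char M (t / sqrt n)) ^ n
        \<le> (1 + b_fun t (M.abs_moment3 / sqrt n + 1 / sqrt n) / n) powr (n / 2)"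
      by (rule M.cmod_char_power_le[OF n])
    also have "\<dots> \<le> exp (1 / 2 * b_fun t (M.abs_moment3 / sqrt n + 1 / sqrt m))"
      using m by (intro M.scaled_b_fun_powr_le) auto
    finally show "cmod (sum_cf P X n t) \<le> exp (1 / 2 * b_fun t (M.abs_moment3 / sqrt n + 1 / sqrt m))"
      by (simp add: cf norm_power)
    define w where "w s = exp ((real m - 1) / (2 * real m)
      * b_fun s (M.abs_moment3 / sqrt n + 1 / sqrt m))" for s
    have "cmod (char M (t / sqrt n) ^ n - normal_cf t) \<le> M.abs_moment3 / sqrt n * normal_cf t *
        (LBINT s:{0..\<bar>t\<bar>}. w s * (s\<^sup>2 / 2) * exp (s\<^sup>2 / 2))"
    proof (rule M.cmod_char_power_minus_normal_le[OF n])
      fix s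
      have "cmod (char M (s / sqrt n)) ^ (n - 1)
          \<le> (1 + b_fun s (M.abs_moment3 / sqrt n + 1 / sqrt n) / n) powr (real (n - 1) / 2)"
        by (rule M.cmod_char_power_le[OF n])
      \<comment> \<open>Here r = (m - 1) / m is at most (n - 1) / n because m <= n.\<close>
      also have "\<dots> \<le> exp ((real m - 1) / m / 2 * b_fun s (M.abs_moment3 / sqrt n + 1 / sqrt m))"
        using m by (intro M.scaled_b_fun_powr_le) (auto simp: of_nat_diff field_simps)
      finally show "cmod (char M (s / sqrt n)) ^ (n - 1) \<le> w s" by (simp add: w_def mult.commute)
      have "b_fun s (M.abs_moment3 / sqrt n + 1 / sqrt m) \<le> 0"
        using m M.abs_moment3_ge_one by (intro b_fun_nonpos add_nonneg_pos) auto
      then have "(real m - 1) / (2 * real m) * b_fun s (M.abs_moment3 / sqrt n + 1 / sqrt m) \<le> 0"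
        using m by (intro mult_nonneg_nonpos) auto
      then show "w s \<le> 1" unfolding w_def by (simp only: exp_le_one_iff)
    qed (unfold w_def, measurable)
    moreover have "w s * (s\<^sup>2 / 2) * exp (s\<^sup>2 / 2) = exp ((real m - 1) / (2 * real m)
        * b_fun s (M.abs_moment3 / sqrt n + 1 / sqrt m) + s\<^sup>2 / 2) * (s\<^sup>2 / 2)" for s
      by (simp only: w_def exp_add mult_ac)
    ultimately show "cmod (char M (t / sqrt n) ^ n - normal_cf t) \<le> M.abs_moment3 / sqrt n * normal_cf t *
        (LBINT s:{0..\<bar>t\<bar>}. exp ((real m - 1) / (2 * real m)
          * b_fun s (M.abs_moment3 / sqrt n + 1 / sqrt m) + s\<^sup>2 / 2) * (s\<^sup>2 / 2))"
      by (simp only:)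
  qed
qed

end
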